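(* Let $d\ge3$, $0<\alpha<d$, and let $\gamma\in C^{d+1}([0,1];\mathbb R^d)$ satisfy $\det(\gamma'(t),\dots,\gamma^{(d)}(t))\ne0$ for all $t\in[0,1]$. Let $\delta\in\mathbb R$ and suppose there is a constant $C$ such that $$\int_0^1|\widehat\mu(\lambda\gamma(t))|^2\,dt\le C\lambda^{-\delta}$$ for all $\lambda>1$ and all positive Borel measures $\mu$ supported in $B(0,1)$ with $I_\alpha(\mu)=1$. Then $$\delta\le\begin{cases}1-\frac{d-\alpha}{2}, & \alpha\in(d-1,d),\\ \min\Big(1-\frac{d-\alpha}{[d-\alpha]+2},\ \frac1{[d-\alpha]+1}\Big), & \alpha\in(1,d-1]\ \ (\text{i.e. } [d-\alpha]\in\{1,\dots,d-2\}),\\ \min\big(\alpha,\frac1d\big), & \alpha\in(0,1].\end{cases}$$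
   Context: $[x]$ denotes the integer part of $x\ge0$. $I_\alpha(\mu)=\iint|x-y|^{-\alpha}\,d\mu(x)\,d\mu(y)$. $\widehat\mu(\xi)=\int e^{ix\cdot\xi}\,d\mu(x)$ (the sign convention is immaterial). *)

theory Defs
  imports "HOL-Analysis.Analysis"
begin

text \<open>Derivatives are taken within the domain S of the curve, so that they are one-sided at the
  endpoints when S is a closed interval, and values of f outside S play no role on S.\<close>

primrec nth_vector_deriv ::
    "nat \<Rightarrow> (real \<Rightarrow> 'a::real_normed_vector) \<Rightarrow> real set \<Rightarrow> real \<Rightarrow> 'a" where
  "nth_vector_deriv 0 f S = f"
| "nth_vector_deriv (Suc k) f S =
     (\<lambda>t. vector_derivative (nth_vector_deriv k f S) (at t within S))"

definition Ck_on :: "nat \<Rightarrow> (real \<Rightarrow> 'a::real_normed_vector) \<Rightarrow> real set \<Rightarrow> bool" where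
  "Ck_on k f S \<longleftrightarrow>
     (\<forall>j<k. nth_vector_deriv j f S differentiable_on S) \<and> continuous_on S (nth_vector_deriv k f S)"

text \<open>The determinant of the matrix with columns \<open>f'(t), \<dots>, f\<^sup>(\<^sup>d\<^sup>)(t)\<close>. The index type has no
  canonical order, so its elements are numbered 1, ..., d by a bijection e: the column with index j
  is the derivative of order e j. Changing e only permutes columns, i.e. affects at most the sign.\<close>

definition deriv_det ::
    "('n::finite \<Rightarrow> nat) \<Rightarrow> (real \<Rightarrow> real ^ 'n) \<Rightarrow> real set \<Rightarrow> real \<Rightarrow> real" where
  "deriv_det e f S t = det (\<chi> i j. nth_vector_deriv (e j) f S t $ i)"

definition measure_support :: "'a::topological_space measure \<Rightarrow> 'a set" where
  "measure_support M = {x. \<forall>U. open U \<longrightarrow> x \<in> U \<longrightarrow> 0 < emeasure M U}"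

text \<open>The kernel \<open>|x - y|\<^sup>-\<^sup>\<alpha>\<close> is infinite on the diagonal; the case distinction is
  needed because \<open>0 powr a = 0\<close> for every real a.\<close>

definition riesz_energy :: "real \<Rightarrow> 'a::euclidean_space measure \<Rightarrow> ennreal" where
  "riesz_energy \<alpha> M =
     (\<integral>\<^sup>+ x. (\<integral>\<^sup>+ y. (if x = y then \<infinity> else ennreal (norm (x - y) powr (- \<alpha>))) \<partial>M) \<partial>M)"

definition fourier_measure :: "'a::euclidean_space measure \<Rightarrow> 'a \<Rightarrow> complex" where
  "fourier_measure M \<xi> = (\<integral>x. exp (\<i> * of_real (x \<bullet> \<xi>)) \<partial>M)"

end

theory Submission
  imports Defs "HOL-Probability.Probability"
begin

text \<open>
  The bound comes from testing the hypothesis on uniform measures on parallelepipeds that are adapted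
  to the curve at the point \<open>\<gamma> 0\<close>.

  Let \<open>v\<^sub>j\<close> be the \<open>j\<close>-th derivative of the curve at \<open>0\<close>, for \<open>1 \<le> j \<le> d\<close>. The torsion condition makes
  these vectors a basis; let \<open>w\<^sub>j\<close> be the dual basis. By Taylor's formula the coordinate
  \<open>w\<^sub>j \<bullet> (\<gamma> t - \<gamma> 0)\<close> is \<open>O(t\<^sup>j)\<close> (\<open>flat_coordinate_bound\<close>). Fix \<open>s \<ge> 0\<close> and let \<open>\<nu>\<close> be the uniform
  probability measure on the box with sides \<open>r\<^sub>j w\<^sub>j\<close>, up to a small constant, where
  \<open>r\<^sub>j = \<lambda> powr (- max 0 (1 - j s))\<close>. On the box and for \<open>0 \<le> t \<le> \<lambda> powr (- s)\<close> the phase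
  \<open>x \<bullet> \<lambda> (\<gamma> t - \<gamma> 0)\<close> stays bounded by 1, because \<open>r\<^sub>j \<lambda> t\<^sup>j \<le> 1\<close>. So the Fourier transform of \<open>\<nu>\<close> is
  at least \<open>1/2\<close> along \<open>\<lambda> (\<gamma> t - \<gamma> 0)\<close> on an interval of length \<open>\<lambda> powr (- s)\<close>.

  The energy of \<open>\<nu>\<close> is estimated by splitting the kernel. If \<open>a\<^sub>j \<in> [0,1)\<close> and \<open>\<Sum> a\<^sub>j = \<alpha>\<close>, then
  \<open>|x|\<^sup>-\<^sup>\<alpha>\<close> is at most a constant times the product of the one-dimensional kernels with exponents
  \<open>a\<^sub>j\<close> in the coordinates of \<open>x\<close>; each of them is integrable, and the energy is
  \<open>O(\<Prod> r\<^sub>j powr (- a\<^sub>j))\<close> (\<open>riesz_energy_distr_cube\<close>).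

  The decay hypothesis concerns positive measures and the frequencies \<open>\<lambda> \<gamma> t\<close>, so the translation by
  \<open>\<lambda> \<gamma> 0\<close> has to be undone, and multiplying \<open>\<nu>\<close> by a character would destroy positivity. But a
  character is a combination of four densities with values in \<open>[0,2]\<close>, whence the hypothesis
  transfers to translated curves (\<open>mean_decay_translated\<close>).

  Comparing powers of \<open>\<lambda>\<close> gives \<open>\<delta> \<le> s + \<Sum> a\<^sub>j max 0 (1 - j s)\<close> for all admissible \<open>s\<close> and \<open>a\<close>
  (\<open>decay_exponent_le_of_box\<close>). Write \<open>k\<close> for the integer part of \<open>d - \<alpha>\<close>. The bounds of
  the theorem are values of the right-hand side, or limits of values:
  \<open>s = 0\<close> gives \<open>\<alpha>\<close>; \<open>s = 1/(k+1)\<close>, with almost all of the exponent on the directions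
  \<open>j > k\<close>, gives \<open>1/(k+1)\<close>; and \<open>s = 1/(k+2)\<close>, with exponents close to 1 on the directions
  \<open>j > k+1\<close> and the rest on \<open>j = k+1\<close>, gives \<open>1 - (d-\<alpha>)/(k+2)\<close>.
  For integer \<open>\<alpha>\<close> that rest would exceed 1, but then the last bound is
  weaker than \<open>1/(k+1)\<close>.
\<close>

section \<open>Flatness of the curve in dual coordinates\<close>

text \<open>This is Taylor's estimate for a function with a zero of order \<open>j\<close> at \<open>0\<close>, with the derivatives
  \<open>g 0, g 1, \<dots>\<close> as a sequence of one-sided derivatives on the interval: integrate the bound \<open>j\<close> times.\<close>
lemma iterated_derivative_bound:
  fixes g :: "nat \<Rightarrow> real \<Rightarrow> real"
  assumes "\<And>i t. i < j \<Longrightarrow> t \<in> {0..1} \<Longrightarrow>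
      (g i has_real_derivative g (Suc i) t) (at t within {0..1})"
    and "\<And>i. i < j \<Longrightarrow> g i 0 = 0"
    and "\<And>t. t \<in> {0..1} \<Longrightarrow> \<bar>g j t\<bar> \<le> K"
    and "t \<in> {0..1}"
  shows "\<bar>g 0 t\<bar> \<le> K * t ^ j"
  using assms
proof (induction j arbitrary: g t)
  case 0
  then show ?case by simp
next
  case (Suc j)
  have "0 \<le> \<bar>g (Suc j) 0\<bar>" by simp
  also have "\<dots> \<le> K" using Suc.prems(3)[of 0] by simp
  finally have "0 \<le> K" .
  have IH: "\<bar>g (Suc 0) u\<bar> \<le> K * u ^ j" if "u \<in> {0..1}" for u
    using Suc.IH[of "\<lambda>i. g (Suc i)" u] Suc.prems that by auto
  have "norm (g 0 t - g 0 0) \<le> (K * t ^ j) * norm (t - 0)"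
  proof (rule field_differentiable_bound[of "{0..t}" _ "g (Suc 0)"])
    fix u assume u: "u \<in> {0..t}"
    then have u1: "u \<in> {0..1}" using Suc.prems(4) by auto
    show "(g 0 has_field_derivative g (Suc 0) u) (at u within {0..t})"
      using Suc.prems(1)[of 0 u] u1 Suc.prems(4) by (auto intro: DERIV_subset)
    have "\<bar>g (Suc 0) u\<bar> \<le> K * u ^ j" by (rule IH[OF u1])
    also have "\<dots> \<le> K * t ^ j"
      using u \<open>0 \<le> K\<close> by (intro mult_left_mono power_mono) auto
    finally show "norm (g (Suc 0) u) \<le> K * t ^ j" by simp
  qed (use Suc.prems(4) in auto)
  then show ?case
    using Suc.prems(2)[of 0] Suc.prems(4) by (simp add: mult_ac)
qed

text \<open>The rows of the inverse of the matrix with columns \<open>v j\<close>.\<close>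
lemma dual_basis_of_det:
  fixes v :: "'n::finite \<Rightarrow> real ^ 'n"
  assumes "det (\<chi> i j. v j $ i) \<noteq> 0"
  obtains w :: "'n \<Rightarrow> real ^ 'n" where "\<And>i j. w i \<bullet> v j = (if i = j then 1 else 0)"
proof -
  let ?A = "\<chi> i j. v j $ i"
  obtain B where B: "B ** ?A = mat 1"
    using assms invertible_det_nz invertible_left_inverse by blast
  have "B $ i \<bullet> v j = (B ** ?A) $ i $ j" for i j
    by (simp add: matrix_matrix_mult_def inner_vec_def)
  then show thesis
    by (intro that[of "\<lambda>i. B $ i"]) (simp add: B mat_def)
qed

lemma Ck_on_continuous_on:
  assumes "Ck_on m f S" "j \<le> m"
  shows "continuous_on S (nth_vector_deriv j f S)"
  using assms by (cases "j = m") (auto simp: Ck_on_def intro: differentiable_imp_continuous_on)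

text \<open>A linear functional that kills the derivatives of order \<open>1, \<dots>, j - 1\<close> at \<open>0\<close> sees the
  curve only to order \<open>j\<close>; the constant is a bound for its \<open>j\<close>-th derivative on the compact interval.\<close>
lemma flat_coordinate_bound:
  fixes \<gamma> :: "real \<Rightarrow> 'a::euclidean_space"
  assumes smooth: "Ck_on m \<gamma> {0..1}" and j: "1 \<le> j" "j \<le> m"
    and flat: "\<And>i. 1 \<le> i \<Longrightarrow> i < j \<Longrightarrow> w \<bullet> nth_vector_deriv i \<gamma> {0..1} 0 = 0"
  shows "\<exists>K\<ge>0. \<forall>t\<in>{0..1}. \<bar>w \<bullet> (\<gamma> t - \<gamma> 0)\<bar> \<le> K * t ^ j"
proof -
  let ?D = "\<lambda>i. nth_vector_deriv i \<gamma> {0..1}"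
  define g where "g i t = (if i = 0 then w \<bullet> (\<gamma> t - \<gamma> 0) else w \<bullet> ?D i t)" for i t
  have "compact ((\<lambda>t. w \<bullet> ?D j t) ` {0..1})"
    by (intro compact_continuous_image continuous_intros Ck_on_continuous_on[OF smooth j(2)]) auto
  then obtain K where "\<forall>u\<in>(\<lambda>t. w \<bullet> ?D j t) ` {0..1}. norm u \<le> K"
    using compact_imp_bounded bounded_iff by metis
  then have K: "\<bar>w \<bullet> ?D j t\<bar> \<le> K" if "t \<in> {0..1}" for t
    using that by auto
  have deriv: "(g i has_real_derivative g (Suc i) t) (at t within {0..1})"
    if "i < j" "t \<in> {0..1}" for i t
  proof -
    have "?D i differentiable at t within {0..1}"
      using smooth that j by (auto simp: Ck_on_def differentiable_on_def)
    then have "(?D i has_vector_derivative ?D (Suc i) t) (at t within {0..1})"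
      by (simp add: vector_derivative_works)
    then have "((\<lambda>t. w \<bullet> ?D i t) has_vector_derivative w \<bullet> ?D (Suc i) t) (at t within {0..1})"
      by (rule bounded_linear.has_vector_derivative[OF bounded_linear_inner_right])
    then have "((\<lambda>t. w \<bullet> ?D i t) has_real_derivative w \<bullet> ?D (Suc i) t) (at t within {0..1})"
      by (simp only: has_real_derivative_iff_has_vector_derivative)
    from this DERIV_diff[OF this DERIV_const[of "w \<bullet> \<gamma> 0"]] show ?thesis
      by (cases "i = 0") (auto simp: g_def[abs_def] inner_diff_right)
  qed
  have "\<bar>g 0 t\<bar> \<le> K * t ^ j" if "t \<in> {0..1}" for t
  proof (rule iterated_derivative_bound[where g = g, OF deriv _ _ that])
    show "g i 0 = 0" if "i < j" for i
      using flat[of i] that by (cases "i = 0") (auto simp: g_def)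
    show "\<bar>g j t\<bar> \<le> K" if "t \<in> {0..1}" for t
      using K[OF that] j by (simp add: g_def)
  qed
  moreover have "0 \<le> K" using K[of 0] by simp
  ultimately show ?thesis by (auto simp: g_def)
qed

section \<open>Riesz energy of images of the unit cube\<close>

definition riesz_kernel :: "real \<Rightarrow> 'a::real_normed_vector \<Rightarrow> ennreal" where
  "riesz_kernel a z = (if z = 0 then \<infinity> else ennreal (norm z powr (- a)))"

lemma borel_measurable_riesz_kernel [measurable]:
  "riesz_kernel a \<in> borel_measurable borel"
  unfolding riesz_kernel_def by measurable

lemma riesz_kernel_pos: "0 < riesz_kernel a z"
  by (simp add: riesz_kernel_def)

lemma riesz_energy_eq:
  "riesz_energy a M = (\<integral>\<^sup>+x. (\<integral>\<^sup>+y. riesz_kernel a (x - y) \<partial>M) \<partial>M)"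
  by (simp add: riesz_energy_def riesz_kernel_def)

abbreviation uniform01 :: "real measure" where
  "uniform01 \<equiv> uniform_measure lborel {0..1}"

lemma prob_space_uniform01: "prob_space uniform01"
  by (intro prob_space_uniform_measure) auto

lemma nn_integral_riesz_kernel_from_0:
  assumes "0 \<le> a" "a < 1"
  shows "(\<integral>\<^sup>+u\<in>{0..1}. riesz_kernel a (u::real) \<partial>lborel) = ennreal (1 / (1 - a))"
proof -
  have "((\<lambda>u. indicator {0..1} u * u powr (- a)) has_integral 1 / (1 - a)) UNIV"
  proof -
    have "((\<lambda>u. u powr (- a)) has_integral 1 / (1 - a)) {0..1::real}"
      using has_integral_powr_from_0[of "- a" 1] assms by simp
    then have "((\<lambda>u. if u \<in> {0..1} then u powr (- a) else 0) has_integral 1 / (1 - a)) UNIV"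
      by (simp only: has_integral_restrict_UNIV)
    then show ?thesis
      by (rule has_integral_eq[rotated]) auto
  qed
  then have "(\<integral>\<^sup>+u. ennreal (indicator {0..1} u * u powr (- a)) \<partial>lborel) = ennreal (1 / (1 - a))"
    by (intro nn_integral_has_integral_lborel) (auto simp: indicator_def)
  moreover have "(\<integral>\<^sup>+u\<in>{0..1}. riesz_kernel a (u::real) \<partial>lborel)
      = (\<integral>\<^sup>+u. ennreal (indicator {0..1} u * u powr (- a)) \<partial>lborel)"
  proof (rule nn_integral_cong_AE)
    have "AE u in lborel. u \<noteq> (0::real)" by (rule AE_lborel_singleton)
    then show "AE u in lborel. riesz_kernel a u * indicator {0..1} u
        = ennreal (indicator {0..1} u * u powr (- a))"
      by eventually_elim (auto simp: riesz_kernel_def indicator_def)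
  qed
  ultimately show ?thesis by simp
qed

text \<open>The bound is uniform in \<open>x\<close>: where \<open>|x - y| > 1\<close> the kernel is at most 1, and the two
  remaining half-intervals around \<open>x\<close> each contribute at most \<open>1 / (1 - a)\<close>.\<close>
lemma riesz_potential_uniform01_bounded:
  assumes a: "0 \<le> a" "a < 1"
  shows "(\<integral>\<^sup>+y. riesz_kernel a (x - y) \<partial>uniform01) \<le> ennreal (1 + 2 / (1 - a))"
proof -
  define k where "k u = (if u \<in> {0..1} then riesz_kernel a (u::real) else 0)" for u
  have [measurable]: "k \<in> borel_measurable borel" unfolding k_def by measurable
  have k: "integral\<^sup>N lborel k = ennreal (1 / (1 - a))"
    unfolding nn_integral_riesz_kernel_from_0[OF a, symmetric]
    by (intro nn_integral_cong) (auto simp: k_def)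
  have "(\<integral>\<^sup>+y. riesz_kernel a (x - y) \<partial>uniform01)
      = (\<integral>\<^sup>+y. riesz_kernel a (x - y) * indicator {0..1} y \<partial>lborel)"
    by (subst nn_integral_uniform_measure) (auto simp: divide_ennreal_def)
  also have "\<dots> \<le> (\<integral>\<^sup>+y. indicator {0..1} y + (k (x - y) + k (y - x)) \<partial>lborel)"
  proof (rule nn_integral_mono)
    fix y :: real
    have "riesz_kernel a (x - y) \<le> 1" if "\<bar>x - y\<bar> > 1"
    proof -
      have "\<bar>x - y\<bar> powr (- a) \<le> \<bar>x - y\<bar> powr 0"
        using that a by (intro powr_mono) auto
      then show ?thesis using that by (auto simp: riesz_kernel_def)
    qed
    moreover have "riesz_kernel a (x - y) = riesz_kernel a (y - x)"
      by (simp add: riesz_kernel_def abs_minus_commute)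
    ultimately show "riesz_kernel a (x - y) * indicator {0..1} y
        \<le> indicator {0..1} y + (k (x - y) + k (y - x))"
      by (cases "\<bar>x - y\<bar> > 1"; cases "x \<ge> y")
        (auto simp: indicator_def k_def intro: add_increasing add_increasing2)
  qed
  also have "\<dots> = (\<integral>\<^sup>+y. indicator {0..1::real} y \<partial>lborel)
      + ((\<integral>\<^sup>+y. k (x - y) \<partial>lborel) + (\<integral>\<^sup>+y. k (y - x) \<partial>lborel))"
    by (simp add: nn_integral_add)
  also have "(\<integral>\<^sup>+y. k (x - y) \<partial>lborel) = integral\<^sup>N lborel k"
    using nn_integral_real_affine[of k "-1" x] by simp
  also have "(\<integral>\<^sup>+y. k (y - x) \<partial>lborel) = integral\<^sup>N lborel k"
    using nn_integral_real_affine[of k 1 "-x"] by simp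
  also have "(\<integral>\<^sup>+y. indicator {0..1::real} y \<partial>lborel) = 1"
    by simp
  also have "1 + (integral\<^sup>N lborel k + integral\<^sup>N lborel k) = ennreal (1 + 2 / (1 - a))"
    using a by (simp add: k ennreal_plus[symmetric] ennreal_1[symmetric] del: ennreal_plus ennreal_1)
  finally show ?thesis .
qed

text \<open>Write \<open>norm z powr (- \<alpha>)\<close> as the product of the \<open>norm z powr (- a i)\<close> and bound
  \<open>norm z\<close> from below by a different coordinate in each factor. All factors are positive, so the right-hand
  side is infinite as soon as one coordinate vanishes, in particular for \<open>z = 0\<close>.\<close>
lemma riesz_kernel_le_prod:
  fixes z :: "'a::real_normed_vector" and u a \<rho> :: "'n::finite \<Rightarrow> real"
  assumes a: "\<And>i. 0 \<le> a i" "(\<Sum>i\<in>UNIV. a i) = \<alpha>"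
    and \<rho>: "\<And>i. 0 < \<rho> i" "\<And>i. \<rho> i * \<bar>u i\<bar> \<le> norm z"
  shows "riesz_kernel \<alpha> z \<le> (\<Prod>i\<in>UNIV. ennreal (\<rho> i powr (- a i)) * riesz_kernel (a i) (u i))"
proof (cases "\<exists>i. u i = 0")
  case True
  then have "(\<Prod>i\<in>UNIV. ennreal (\<rho> i powr (- a i)) * riesz_kernel (a i) (u i)) = \<infinity>"
    using \<rho>(1)
    by (auto simp: ennreal_prod_eq_top riesz_kernel_def ennreal_mult_eq_top_iff less_imp_neq[symmetric])
  then show ?thesis by simp
next
  case False
  then have u: "u i \<noteq> 0" for i by auto
  have z: "norm z > 0"
    using \<rho>(1)[of undefined] \<rho>(2)[of undefined] u[of undefined]
    by (metis less_le_trans mult_pos_pos zero_less_abs_iff)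
  have "norm z powr (- \<alpha>) = (\<Prod>i\<in>UNIV. norm z powr (- a i))"
    using z by (simp add: powr_sum[symmetric] sum_negf a)
  also have "\<dots> \<le> (\<Prod>i\<in>UNIV. \<rho> i powr (- a i) * \<bar>u i\<bar> powr (- a i))"
  proof (intro prod_mono conjI)
    fix i
    have "norm z powr (- a i) \<le> (\<rho> i * \<bar>u i\<bar>) powr (- a i)"
      using \<rho>(1)[of i] \<rho>(2)[of i] u[of i] a(1)[of i] by (intro powr_mono2') auto
    also have "\<dots> = \<rho> i powr (- a i) * \<bar>u i\<bar> powr (- a i)"
      using \<rho>(1)[of i] by (simp add: powr_mult less_imp_le)
    finally show "norm z powr (- a i) \<le> \<rho> i powr (- a i) * \<bar>u i\<bar> powr (- a i)" .
  qed simp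
  finally have "ennreal (norm z powr (- \<alpha>))
      \<le> ennreal (\<Prod>i\<in>UNIV. \<rho> i powr (- a i) * \<bar>u i\<bar> powr (- a i))"
    by (rule ennreal_leI)
  then show ?thesis
    using z u by (simp add: riesz_kernel_def prod_ennreal[symmetric] ennreal_mult)
qed

text \<open>A map that expands the \<open>i\<close>-th coordinate at least by \<open>\<rho> i\<close>
  pushes the uniform measure of the cube to a measure of finite energy: by the product bound for the kernel,
  the potential at any point of the image is at most a product of one-dimensional potentials.\<close>
lemma riesz_energy_distr_cube:
  fixes T :: "('n::finite \<Rightarrow> real) \<Rightarrow> 'a::euclidean_space" and a \<rho> :: "'n \<Rightarrow> real"
  assumes T [measurable]: "T \<in> measurable (Pi\<^sub>M UNIV (\<lambda>_. uniform01)) borel"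
    and a: "\<And>i. 0 \<le> a i" "\<And>i. a i < 1" "(\<Sum>i\<in>UNIV. a i) = \<alpha>"
    and \<rho>: "\<And>i. 0 < \<rho> i" "\<And>f f' i. \<rho> i * \<bar>f i - f' i\<bar> \<le> norm (T f - T f')"
  shows "riesz_energy \<alpha> (distr (Pi\<^sub>M UNIV (\<lambda>_. uniform01)) borel T)
    \<le> ennreal (\<Prod>i\<in>UNIV. (1 + 2 / (1 - a i)) * \<rho> i powr (- a i))"
proof -
  let ?P = "Pi\<^sub>M (UNIV :: 'n set) (\<lambda>_. uniform01)"
  let ?B = "\<Prod>i\<in>UNIV. (1 + 2 / (1 - a i)) * \<rho> i powr (- a i)"
  interpret product_prob_space "\<lambda>_. uniform01" "UNIV :: 'n set"
    by (intro product_prob_spaceI prob_space_uniform01)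
  interpret P: prob_space ?P
    by (intro prob_space_PiM prob_space_uniform01)
  interpret D: prob_space "distr ?P borel T"
    by (rule P.prob_space_distr[OF T])
  have [measurable_cong]: "sets uniform01 = sets borel"
    by simp
  have potential: "(\<integral>\<^sup>+f'. riesz_kernel \<alpha> (T f - T f') \<partial>?P) \<le> ennreal ?B" for f
  proof -
    have "(\<integral>\<^sup>+f'. riesz_kernel \<alpha> (T f - T f') \<partial>?P)
        \<le> (\<integral>\<^sup>+f'. (\<Prod>i\<in>UNIV. ennreal (\<rho> i powr (- a i)) * riesz_kernel (a i) (f i - f' i)) \<partial>?P)"
      using a \<rho> by (intro nn_integral_mono riesz_kernel_le_prod) auto
    also have "\<dots> = (\<Prod>i\<in>UNIV. (\<integral>\<^sup>+y. ennreal (\<rho> i powr (- a i)) * riesz_kernel (a i) (f i - y) \<partial>uniform01))"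
      by (rule product_nn_integral_prod) auto
    also have "\<dots> = (\<Prod>i\<in>UNIV. ennreal (\<rho> i powr (- a i)) * (\<integral>\<^sup>+y. riesz_kernel (a i) (f i - y) \<partial>uniform01))"
      by (intro prod.cong refl nn_integral_cmult) auto
    also have "\<dots> \<le> (\<Prod>i\<in>UNIV. ennreal (\<rho> i powr (- a i)) * ennreal (1 + 2 / (1 - a i)))"
      using a by (intro prod_mono_ennreal mult_left_mono riesz_potential_uniform01_bounded) auto
    also have "\<dots> = ennreal ?B"
      using a(2) by (simp add: ennreal_mult'[symmetric] prod_ennreal mult.commute less_imp_le del: ennreal_plus)
    finally show ?thesis .
  qed
  have "riesz_energy \<alpha> (distr ?P borel T)
      = (\<integral>\<^sup>+f. (\<integral>\<^sup>+f'. riesz_kernel \<alpha> (T f - T f') \<partial>?P) \<partial>?P)"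
    unfolding riesz_energy_eq
    by (subst nn_integral_distr, measurable) (simp add: nn_integral_distr)
  also have "\<dots> \<le> (\<integral>\<^sup>+f. ennreal ?B \<partial>?P)"
    by (intro nn_integral_mono potential)
  also have "\<dots> = ennreal ?B"
    by (simp add: P.emeasure_space_1)
  finally show ?thesis .
qed

section \<open>Densities, supports and Fourier transforms\<close>

lemma riesz_energy_density:
  fixes M :: "'a::euclidean_space measure" and g :: "'a \<Rightarrow> ennreal"
  assumes "finite_measure M" and sets [measurable_cong]: "sets M = sets borel"
    and g [measurable]: "g \<in> borel_measurable borel"
  shows "riesz_energy a (density M g)
    = (\<integral>\<^sup>+x. g x * (\<integral>\<^sup>+y. g y * riesz_kernel a (x - y) \<partial>M) \<partial>M)"
proof -
  interpret finite_measure M by fact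
  show ?thesis
    unfolding riesz_energy_eq by (simp add: nn_integral_density)
qed

lemma riesz_energy_density_const:
  fixes M :: "'a::euclidean_space measure"
  assumes "finite_measure M" and sets [measurable_cong]: "sets M = sets borel"
  shows "riesz_energy a (density M (\<lambda>_. c)) = c\<^sup>2 * riesz_energy a M"
proof -
  interpret finite_measure M by fact
  show ?thesis
    unfolding riesz_energy_density[OF assms, of "\<lambda>_. c", simplified]
    by (simp add: riesz_energy_eq nn_integral_cmult power2_eq_square mult.assoc)
qed

lemma riesz_energy_density_le:
  fixes M :: "'a::euclidean_space measure"
  assumes "finite_measure M" and sets [measurable_cong]: "sets M = sets borel"
    and g [measurable]: "g \<in> borel_measurable borel" and le: "\<And>x. g x \<le> c"
  shows "riesz_energy a (density M g) \<le> c\<^sup>2 * riesz_energy a M"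
proof -
  have "riesz_energy a (density M g) \<le> riesz_energy a (density M (\<lambda>_. c))"
    unfolding riesz_energy_density[OF assms(1-3)]
      riesz_energy_density[OF assms(1,2), of "\<lambda>_. c", simplified]
    by (intro nn_integral_mono mult_mono le) auto
  also have "\<dots> = c\<^sup>2 * riesz_energy a M"
    by (rule riesz_energy_density_const[OF assms(1,2)])
  finally show ?thesis .
qed

text \<open>The kernel is positive everywhere, so only the zero measure has energy 0.\<close>
lemma riesz_energy_eq_0D:
  fixes M :: "'a::euclidean_space measure"
  assumes "finite_measure M" and sets [measurable_cong]: "sets M = sets borel"
    and "riesz_energy a M = 0"
  shows "AE x in M. False"
proof -
  interpret finite_measure M by fact
  have ae: "AE x in M. (\<integral>\<^sup>+y. riesz_kernel a (x - y) \<partial>M) = 0"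
    using assms(3) by (subst (asm) riesz_energy_eq, subst (asm) nn_integral_0_iff_AE) auto
  have null: "AE y in M. False" if "(\<integral>\<^sup>+y. riesz_kernel a (x - y) \<partial>M) = 0" for x
    using that riesz_kernel_pos by (subst (asm) nn_integral_0_iff_AE) (auto simp: less_le)
  show ?thesis
  proof (cases "\<exists>x. (\<integral>\<^sup>+y. riesz_kernel a (x - y) \<partial>M) = 0")
    case True
    then show ?thesis using null by blast
  next
    case False
    then show ?thesis using ae by simp
  qed
qed

text \<open>Since the closed ball of radius \<open>r\<close> carries the measure, its complement is an open null set.\<close>
lemma measure_support_subset_ball:
  fixes M :: "'a::euclidean_space measure"
  assumes [measurable_cong]: "sets M = sets borel" and "AE x in M. norm x \<le> r" "r < R"
  shows "measure_support M \<subseteq> ball 0 R"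
proof
  fix x assume x: "x \<in> measure_support M"
  show "x \<in> ball 0 R"
  proof (rule ccontr)
    assume "x \<notin> ball 0 R"
    then have "x \<in> - cball 0 r" using assms(3) by auto
    moreover have "emeasure M (- cball 0 r) = 0"
      using assms(2) by (subst (asm) AE_iff_measurable[of "- cball 0 r"])
        (auto simp: sets_eq_imp_space_eq[OF assms(1)])
    ultimately show False
      using x by (auto simp: measure_support_def dest!: spec[of _ "- cball 0 r"])
  qed
qed

lemma integrable_character:
  fixes M :: "'a::euclidean_space measure"
  assumes "finite_measure M" and [measurable_cong]: "sets M = sets borel"
  shows "integrable M (\<lambda>x. exp (\<i> * of_real (x \<bullet> \<xi>)) :: complex)"
proof -
  interpret finite_measure M by fact
  show ?thesis by (rule integrable_const_bound[where B = 1]) auto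
qed

lemma continuous_on_fourier_measure:
  fixes M :: "'a::euclidean_space measure"
  assumes "finite_measure M" and [measurable_cong]: "sets M = sets borel"
  shows "continuous_on A (fourier_measure M)"
proof -
  interpret finite_measure M by fact
  have "isCont (fourier_measure M) \<xi>" for \<xi>
    unfolding continuous_at_sequentially
  proof safe
    fix X assume X: "X \<longlonglongrightarrow> \<xi>"
    show "(fourier_measure M \<circ> X) \<longlonglongrightarrow> fourier_measure M \<xi>"
      unfolding comp_def fourier_measure_def
      by (rule integral_dominated_convergence[where w="\<lambda>_. 1"])
        (auto intro!: tendsto_intros X)
  qed
  then show ?thesis by (simp add: continuous_at_imp_continuous_on)
qed

text \<open>All the unimodular numbers that are averaged have argument in \<open>[-1, 1] \<subseteq> [-\<pi>/3, \<pi>/3]\<close>,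
  hence real part at least \<open>1/2\<close>.\<close>
lemma cmod_fourier_measure_ge_half:
  fixes M :: "'a::euclidean_space measure"
  assumes "prob_space M" and [measurable_cong]: "sets M = sets borel"
    and phase: "AE x in M. \<bar>x \<bullet> \<xi>\<bar> \<le> 1"
  shows "1 / 2 \<le> cmod (fourier_measure M \<xi>)"
proof -
  interpret prob_space M by fact
  have int: "integrable M (\<lambda>x. exp (\<i> * of_real (x \<bullet> \<xi>)) :: complex)"
    by (rule integrable_character) (use assms finite_measure_axioms in auto)
  have cos_ge: "1 / 2 \<le> cos u" if "\<bar>u\<bar> \<le> 1" for u :: real
  proof -
    have "cos (pi / 3) \<le> cos \<bar>u\<bar>"
      using that pi_gt3 by (intro cos_monotone_0_pi_le) auto
    then show ?thesis by (simp add: cos_60)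
  qed
  have "1 / 2 = (\<integral>x. (1 / 2 :: real) \<partial>M)" by (simp add: prob_space)
  also have "\<dots> \<le> (\<integral>x. Re (exp (\<i> * of_real (x \<bullet> \<xi>))) \<partial>M)"
  proof (rule integral_mono_AE)
    show "AE x in M. 1 / 2 \<le> Re (exp (\<i> * of_real (x \<bullet> \<xi>)))"
      using phase by eventually_elim (use cos_ge in \<open>simp add: Re_exp\<close>)
  qed (use int in auto)
  also have "\<dots> = Re (fourier_measure M \<xi>)"
    unfolding fourier_measure_def using int by simp
  also have "\<dots> \<le> cmod (fourier_measure M \<xi>)" by (rule complex_Re_le_cmod)
  finally show ?thesis .
qed

section \<open>Decay for translated curves\<close>

definition mean_decay ::
    "real \<Rightarrow> real \<Rightarrow> (real \<Rightarrow> 'a::euclidean_space) \<Rightarrow> real \<Rightarrow> bool" where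
  "mean_decay \<alpha> \<delta> \<gamma> C \<longleftrightarrow> (\<forall>l \<mu>.
     l > 1 \<longrightarrow> sets \<mu> = sets borel \<longrightarrow> measure_support \<mu> \<subseteq> ball 0 1 \<longrightarrow> riesz_energy \<alpha> \<mu> = 1 \<longrightarrow>
     integral {0..1} (\<lambda>t. (cmod (fourier_measure \<mu> (l *\<^sub>R \<gamma> t)))\<^sup>2) \<le> C * l powr (- \<delta>))"

text \<open>Both sides are quadratic in the measure, so a measure of positive finite energy can be scaled
  to energy 1, and a measure of energy 0 vanishes.\<close>
lemma mean_decay_homogeneous:
  fixes M :: "'a::euclidean_space measure"
  assumes decay: "mean_decay \<alpha> \<delta> \<gamma> C"
    and l: "l > 1"
    and M: "finite_measure M" "sets M = sets borel" "AE x in M. norm x \<le> 1 / 2"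
    and E: "riesz_energy \<alpha> M \<le> ennreal E" "0 \<le> E"
  shows "integral {0..1} (\<lambda>t. (cmod (fourier_measure M (l *\<^sub>R \<gamma> t)))\<^sup>2) \<le> \<bar>C\<bar> * E * l powr (- \<delta>)"
    (is "?A \<le> _")
proof (cases "riesz_energy \<alpha> M = 0")
  case True
  then have "AE x in M. False" by (intro riesz_energy_eq_0D M)
  then have "fourier_measure M \<xi> = 0" for \<xi>
    unfolding fourier_measure_def by (intro integral_eq_zero_AE) auto
  then show ?thesis using E by simp
next
  case False
  define I where "I = enn2real (riesz_energy \<alpha> M)"
  have I: "riesz_energy \<alpha> M = ennreal I"
    using le_less_trans[OF E(1) ennreal_less_top] by (simp add: I_def)
  have I_pos: "0 < I" and I_le: "I \<le> E"
    using False E unfolding I by (simp_all add: ennreal_eq_0_iff not_le ennreal_le_iff)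
  define c where "c = 1 / sqrt I"
  define N where "N = density M (\<lambda>_. ennreal c)"
  have c: "0 \<le> c" "c\<^sup>2 = 1 / I" using I_pos by (auto simp: c_def power_divide)
  have N: "sets N = sets borel" by (simp add: N_def M)
  have "AE x in N. norm x \<le> 1 / 2"
    unfolding N_def using M(3) by (subst AE_density) auto
  then have supp: "measure_support N \<subseteq> ball 0 1"
    by (rule measure_support_subset_ball[OF N]) simp
  have "riesz_energy \<alpha> N = ennreal (c\<^sup>2) * ennreal I"
    unfolding N_def using c by (simp add: riesz_energy_density_const[OF M(1,2)] I ennreal_power)
  also have "\<dots> = 1" using I_pos by (simp add: c ennreal_mult'[symmetric])
  finally have "integral {0..1} (\<lambda>t. (cmod (fourier_measure N (l *\<^sub>R \<gamma> t)))\<^sup>2) \<le> C * l powr (- \<delta>)"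
    using decay l N supp by (auto simp: mean_decay_def)
  moreover have "fourier_measure N \<xi> = c * fourier_measure M \<xi>" for \<xi>
  proof -
    have [measurable_cong]: "sets M = sets borel" by (rule M)
    show ?thesis unfolding fourier_measure_def N_def
      using c by (subst integral_density) (auto simp: scaleR_conv_of_real)
  qed
  ultimately have "c\<^sup>2 * ?A \<le> C * l powr (- \<delta>)"
    by (simp add: norm_mult power_mult_distrib)
  then have "(c\<^sup>2 * ?A) * I \<le> (C * l powr (- \<delta>)) * I"
    using I_pos by (intro mult_right_mono) auto
  also have "\<dots> \<le> (\<bar>C\<bar> * l powr (- \<delta>)) * E"
    using I_pos I_le by (intro mult_mono mult_right_mono mult_nonneg_nonneg abs_ge_self abs_ge_zero powr_ge_zero) simp_all
  also have "(c\<^sup>2 * ?A) * I = ?A"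
    using I_pos by (simp add: c(2))
  finally show ?thesis by (simp only: mult_ac)
qed

text \<open>With \<open>u = x \<bullet> \<eta>\<close>, the character that shifts the frequency by \<open>-\<eta>\<close> is given by
  \<open>2 exp (- \<i> u) = (1 + cos u) - (1 - cos u) - \<i> ((1 + sin u) - (1 - sin u))\<close>. The four densities on the
  right take values in \<open>[0, 2]\<close>, so the measures that they define are positive with energy at most
  \<open>4 E\<close>, and their decay estimates add up.\<close>
lemma mean_decay_translated:
  fixes M :: "'a::euclidean_space measure"
  assumes decay: "mean_decay \<alpha> \<delta> \<gamma> C"
    and \<gamma>: "continuous_on {0..1} \<gamma>"
    and l: "l > 1"
    and M: "finite_measure M" "sets M = sets borel" "AE x in M. norm x \<le> 1 / 2"
    and E: "riesz_energy \<alpha> M \<le> ennreal E" "0 \<le> E"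
  shows "integral {0..1} (\<lambda>t. (cmod (fourier_measure M (l *\<^sub>R \<gamma> t - \<eta>)))\<^sup>2)
    \<le> 16 * \<bar>C\<bar> * E * l powr (- \<delta>)"
proof -
  have [measurable_cong]: "sets M = sets borel" by (rule M)
  interpret finite_measure M by fact
  \<comment> \<open>The four densities, as one formula with phase shifts by quarter turns.\<close>
  define g where "g k x = 1 + cos (x \<bullet> \<eta> - real k * (pi / 2))" for k and x :: 'a
  define N where "N k = density M (\<lambda>x. ennreal (g k x))" for k
  have g_meas [measurable]: "g k \<in> borel_measurable borel" for k
    unfolding g_def by measurable
  have g: "0 \<le> g k x" "g k x \<le> 2" for k x
    using cos_ge_minus_one[of "x \<bullet> \<eta> - real k * (pi / 2)"] cos_le_one[of "x \<bullet> \<eta> - real k * (pi / 2)"]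
    unfolding g_def by linarith+
  have g_eval: "g 0 x = 1 + cos (x \<bullet> \<eta>)" "g 1 x = 1 + sin (x \<bullet> \<eta>)"
      "g 2 x = 1 - cos (x \<bullet> \<eta>)" "g 3 x = 1 - sin (x \<bullet> \<eta>)" for x
    using cos_3over2_pi sin_3over2_pi by (simp_all add: g_def cos_diff mult.commute)
  have g_le: "ennreal (g k x) \<le> 2" for k x
    using ennreal_leI[OF g(2)[of k x]] by simp
  have finN: "finite_measure (N k)" for k
  proof
    have "emeasure (N k) (space (N k)) = (\<integral>\<^sup>+x. ennreal (g k x) \<partial>M)"
      unfolding N_def using g_meas by (subst emeasure_density) (auto intro!: nn_integral_cong)
    also have "\<dots> \<le> (\<integral>\<^sup>+x. 2 \<partial>M)"
      using g by (intro nn_integral_mono g_le)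
    also have "\<dots> = ennreal (2 * measure M (space M))"
      by (simp add: emeasure_eq_measure ennreal_mult')
    finally show "emeasure (N k) (space (N k)) \<noteq> \<infinity>" by (auto simp: top_unique)
  qed
  have setsN: "sets (N k) = sets borel" for k by (simp add: N_def M)
  have FN: "fourier_measure (N k) \<xi> = (\<integral>x. of_real (g k x) * exp (\<i> * of_real (x \<bullet> \<xi>)) \<partial>M)" for k \<xi>
    unfolding fourier_measure_def N_def using g g_meas
    by (subst integral_density) (auto simp: scaleR_conv_of_real)
  have bound: "integral {0..1} (\<lambda>t. (cmod (fourier_measure (N k) (l *\<^sub>R \<gamma> t)))\<^sup>2)
      \<le> \<bar>C\<bar> * (4 * E) * l powr (- \<delta>)" for k
  proof (rule mean_decay_homogeneous[OF decay l finN setsN])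
    show "AE x in N k. norm x \<le> 1 / 2"
      unfolding N_def using M(3) g_meas by (subst AE_density) auto
    have "riesz_energy \<alpha> (N k) \<le> 2\<^sup>2 * riesz_energy \<alpha> M"
      unfolding N_def using M g g_meas
      by (intro riesz_energy_density_le g_le) auto
    also have "\<dots> \<le> 4 * ennreal E" using E by (intro mult_mono) auto
    finally show "riesz_energy \<alpha> (N k) \<le> ennreal (4 * E)"
      using E by (simp add: ennreal_mult')
  qed (use E in auto)
  have cont: "continuous_on {0..1} (\<lambda>t. fourier_measure K (l *\<^sub>R \<gamma> t - \<zeta>))"
    if "finite_measure K" "sets K = sets borel" for K :: "'a measure" and \<zeta>
    by (rule continuous_on_compose2[OF continuous_on_fourier_measure[OF that, of UNIV]])
      (auto intro!: continuous_intros \<gamma>)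
  have int: "(\<lambda>t. (cmod (fourier_measure K (l *\<^sub>R \<gamma> t - \<zeta>)))\<^sup>2) integrable_on {0..1}"
    if "finite_measure K" "sets K = sets borel" for K :: "'a measure" and \<zeta>
    by (intro integrable_continuous_interval continuous_intros cont that)
  have int0: "(\<lambda>t. (cmod (fourier_measure (N k) (l *\<^sub>R \<gamma> t)))\<^sup>2) integrable_on {0..1}"
    for k
    using int[OF finN setsN, of k 0] by simp
  \<comment> \<open>The factor 4 lost in the Cauchy-Schwarz inequality for four terms cancels against the square of the factor 2 of the character.\<close>
  have pointwise: "(cmod (fourier_measure M (\<xi> - \<eta>)))\<^sup>2 \<le> (\<Sum>k<4. (cmod (fourier_measure (N k) \<xi>))\<^sup>2)" for \<xi>
  proof -
    let ?h = "\<lambda>k x. of_real (g k x) * exp (\<i> * of_real (x \<bullet> \<xi>)) :: complex"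
    have int_h: "integrable M (?h k)" for k
      using g g_meas
      by (intro integrable_const_bound[where B = 2]) (auto simp: norm_mult)
    have split: "2 * exp (\<i> * of_real (x \<bullet> (\<xi> - \<eta>)))
        = ?h 0 x - ?h 2 x - \<i> * (?h 1 x - ?h 3 x)" for x
    proof -
      have "exp (\<i> * of_real (x \<bullet> (\<xi> - \<eta>)))
          = exp (\<i> * of_real (x \<bullet> \<xi>)) * exp (\<i> * of_real (- (x \<bullet> \<eta>)))"
        by (simp add: inner_diff_right exp_add[symmetric] algebra_simps)
      also have "exp (\<i> * of_real (- (x \<bullet> \<eta>))) = of_real (cos (x \<bullet> \<eta>)) - \<i> * of_real (sin (x \<bullet> \<eta>))"
        by (simp add: complex_eq_iff Re_exp Im_exp)
      finally have "2 * exp (\<i> * of_real (x \<bullet> (\<xi> - \<eta>)))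
          = 2 * (exp (\<i> * of_real (x \<bullet> \<xi>)) * (of_real (cos (x \<bullet> \<eta>)) - \<i> * of_real (sin (x \<bullet> \<eta>))))"
        by (simp only:)
      then show ?thesis unfolding g_eval by (simp add: left_diff_distrib right_diff_distrib distrib_right)
    qed
    have "2 * fourier_measure M (\<xi> - \<eta>) = (\<integral>x. 2 * exp (\<i> * of_real (x \<bullet> (\<xi> - \<eta>))) \<partial>M)"
      unfolding fourier_measure_def by simp
    also have "\<dots> = (\<integral>x. ?h 0 x - ?h 2 x - \<i> * (?h 1 x - ?h 3 x) \<partial>M)"
      by (simp only: split)
    also have "\<dots> = fourier_measure (N 0) \<xi> - fourier_measure (N 2) \<xi>
        - \<i> * (fourier_measure (N 1) \<xi> - fourier_measure (N 3) \<xi>)"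
      using int_h[of 0] int_h[of 1] int_h[of 2] int_h[of 3] by (simp add: FN)
    finally have "2 * cmod (fourier_measure M (\<xi> - \<eta>)) \<le> (\<Sum>k<4. cmod (fourier_measure (N k) \<xi>))"
      using norm_triangle_ineq4[of "fourier_measure (N 0) \<xi> - fourier_measure (N 2) \<xi>"
          "\<i> * (fourier_measure (N 1) \<xi> - fourier_measure (N 3) \<xi>)"]
        norm_triangle_ineq4[of "fourier_measure (N 0) \<xi>" "fourier_measure (N 2) \<xi>"]
        norm_triangle_ineq4[of "fourier_measure (N 1) \<xi>" "fourier_measure (N 3) \<xi>"]
        norm_mult[of 2 "fourier_measure M (\<xi> - \<eta>)"]
      by (simp add: norm_mult eval_nat_numeral)
    then have "(2 * cmod (fourier_measure M (\<xi> - \<eta>)))\<^sup>2 \<le> (\<Sum>k<4. cmod (fourier_measure (N k) \<xi>))\<^sup>2"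
      by (intro power_mono) auto
    also have "\<dots> \<le> (\<Sum>k<4::nat. (1::real)\<^sup>2) * (\<Sum>k<4. (cmod (fourier_measure (N k) \<xi>))\<^sup>2)"
      using Cauchy_Schwarz_ineq_sum[of "\<lambda>_. 1" "\<lambda>k. cmod (fourier_measure (N k) \<xi>)" "{..<4::nat}"]
      by simp
    finally show ?thesis by (simp add: power_mult_distrib)
  qed
  have "integral {0..1} (\<lambda>t. (cmod (fourier_measure M (l *\<^sub>R \<gamma> t - \<eta>)))\<^sup>2)
      \<le> integral {0..1} (\<lambda>t. \<Sum>k<4. (cmod (fourier_measure (N k) (l *\<^sub>R \<gamma> t)))\<^sup>2)"
    by (intro integral_le int M pointwise integrable_sum int0) auto
  also have "\<dots> = (\<Sum>k<4. integral {0..1} (\<lambda>t. (cmod (fourier_measure (N k) (l *\<^sub>R \<gamma> t)))\<^sup>2))"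
    by (intro integral_sum int0 finite_lessThan)
  also have "\<dots> \<le> (\<Sum>k<4::nat. \<bar>C\<bar> * (4 * E) * l powr (- \<delta>))"
    by (intro sum_mono bound)
  finally show ?thesis by simp
qed

section \<open>The exponent of a box\<close>

lemma powr_bounded_imp_nonpos:
  fixes p B :: real
  assumes "\<And>l. l > 1 \<Longrightarrow> l powr p \<le> B"
  shows "p \<le> 0"
proof (rule ccontr)
  assume "\<not> p \<le> 0"
  then have p: "p > 0" by simp
  let ?l = "(max B 1 + 1) powr (1 / p)"
  have "?l > 1" using p by (intro gr_one_powr) auto
  then have "?l powr p \<le> B" by (rule assms)
  then show False using p by (simp add: powr_powr)
qed

text \<open>The test measure is uniform on the box with sides \<open>c * r i\<close> along the dual basis \<open>w i\<close>,
  where \<open>r i = l powr (- max 0 (1 - e i * s))\<close>. The exponents \<open>a i\<close> distribute the singularity of the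
  kernel over the directions; short sides are expensive in proportion to \<open>a i\<close>. The first summand \<open>s\<close> is the
  cost of restricting to the interval of parameters of length \<open>l powr (- s)\<close>.\<close>
lemma decay_exponent_le_of_box:
  fixes \<gamma> :: "real \<Rightarrow> real ^ 'n" and e :: "'n \<Rightarrow> nat" and a :: "'n \<Rightarrow> real"
  assumes decay: "mean_decay \<alpha> \<delta> \<gamma> C"
    and smooth: "Ck_on m \<gamma> {0..1}"
    and e: "\<And>i. 1 \<le> e i" "\<And>i. e i \<le> m" "\<And>j k. 1 \<le> j \<Longrightarrow> j < e k \<Longrightarrow> j \<in> range e"
    and torsion: "deriv_det e \<gamma> {0..1} 0 \<noteq> 0"
    and a: "\<And>i. 0 \<le> a i" "\<And>i. a i < 1" "(\<Sum>i\<in>UNIV. a i) = \<alpha>"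
    and s: "0 \<le> s"
  shows "\<delta> \<le> s + (\<Sum>i\<in>UNIV. a i * max 0 (1 - real (e i) * s))"
proof -
  define v where "v i = nth_vector_deriv (e i) \<gamma> {0..1} 0" for i
  obtain w where w: "\<And>i j. w i \<bullet> v j = (if i = j then 1 else 0)"
    using torsion dual_basis_of_det[of v] unfolding deriv_det_def v_def by blast
  have "\<exists>K\<ge>0. \<forall>t\<in>{0..1}. \<bar>w i \<bullet> (\<gamma> t - \<gamma> 0)\<bar> \<le> K * t ^ e i" for i
  proof (rule flat_coordinate_bound[OF smooth e(1,2)])
    fix j assume j: "1 \<le> j" "j < e i"
    then obtain k where "j = e k" using e(3) by blast
    then show "w i \<bullet> nth_vector_deriv j \<gamma> {0..1} 0 = 0"
      using w[of i k] j by (auto simp: v_def)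
  qed
  then obtain K where K: "\<And>i. 0 \<le> K i"
    "\<And>i t. t \<in> {0..1} \<Longrightarrow> \<bar>w i \<bullet> (\<gamma> t - \<gamma> 0)\<bar> \<le> K i * t ^ e i"
    by metis
  \<comment> \<open>Small enough for the box to lie in the ball of radius 1/2 and for the phase to stay below 1.\<close>
  define c where "c = 1 / (2 * (1 + (\<Sum>i\<in>UNIV. norm (w i)) + (\<Sum>i\<in>UNIV. K i)))"
  have sums_nonneg: "0 \<le> (\<Sum>i\<in>UNIV. norm (w i))" "0 \<le> (\<Sum>i\<in>UNIV. K i)"
    by (auto intro: sum_nonneg K)
  have c: "0 < c" "c * (\<Sum>i\<in>UNIV. norm (w i)) \<le> 1 / 2" "c * (\<Sum>i\<in>UNIV. K i) \<le> 1"
    using sums_nonneg by (auto simp: c_def field_simps)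
  have v_pos: "0 < norm (v i)" for i
    using w[of i i] by auto
  define \<theta> where "\<theta> i = max 0 (1 - real (e i) * s)" for i
  define S where "S = (\<Sum>i\<in>UNIV. a i * \<theta> i)"
  define D where "D = (\<Prod>i\<in>UNIV. (1 + 2 / (1 - a i)) * (c / norm (v i)) powr (- a i))"
  have cont: "continuous_on {0..1} \<gamma>"
    using Ck_on_continuous_on[OF smooth, of 0] by simp
  have main: "l powr (\<delta> - s - S) \<le> 64 * \<bar>C\<bar> * D" if l: "l > 1" for l
  proof -
    define r where "r i = l powr (- \<theta> i)" for i
    have r: "0 < r i" "r i \<le> 1" for i
      using l powr_mono[of "- \<theta> i" 0 l] by (auto simp: r_def \<theta>_def)
    define T :: "('n \<Rightarrow> real) \<Rightarrow> real ^ 'n" where "T f = (\<Sum>i\<in>UNIV. (c * r i * f i) *\<^sub>R w i)" for f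
    define P where "P = Pi\<^sub>M (UNIV :: 'n set) (\<lambda>_. uniform01)"
    define \<nu> where "\<nu> = distr P borel T"
    interpret P: prob_space P
      unfolding P_def by (intro prob_space_PiM prob_space_uniform01)
    have [measurable_cong]: "sets uniform01 = sets borel" by simp
    have T [measurable]: "T \<in> measurable P borel"
      unfolding T_def P_def by measurable
    interpret \<nu>: prob_space \<nu>
      unfolding \<nu>_def by (rule P.prob_space_distr[OF T])
    have sets_\<nu> [measurable_cong]: "sets \<nu> = sets borel" by (simp add: \<nu>_def)
    have cube: "AE f in P. \<forall>i. f i \<in> {0..1}"
    proof -
      have "AE f in P. f i \<in> {0..1}" for i
        unfolding P_def
        by (intro AE_PiM_component prob_space_uniform01 AE_uniform_measureI) auto
      then show ?thesis by (simp add: AE_all_countable)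
    qed
    have T_inner: "T f \<bullet> z = (\<Sum>i\<in>UNIV. (c * r i * f i) * (w i \<bullet> z))" for f z
      by (simp add: T_def inner_sum_left)
    have "AE f in P. norm (T f) \<le> 1 / 2"
      using cube
    proof eventually_elim
      case (elim f)
      have "norm (T f) \<le> (\<Sum>i\<in>UNIV. norm ((c * r i * f i) *\<^sub>R w i))"
        unfolding T_def by (rule norm_sum)
      also have "\<dots> \<le> (\<Sum>i\<in>UNIV. c * norm (w i))"
      proof (rule sum_mono)
        fix i
        have "r i * f i \<le> 1 * 1" using elim r[of i] by (intro mult_mono) auto
        then have "c * (r i * f i) * norm (w i) \<le> c * 1 * norm (w i)"
          using c by (intro mult_right_mono mult_left_mono) auto
        then show "norm ((c * r i * f i) *\<^sub>R w i) \<le> c * norm (w i)"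
          using elim r[of i] c by (simp add: abs_mult mult.assoc)
      qed
      also have "\<dots> \<le> 1 / 2" using c by (simp add: sum_distrib_left)
      finally show ?case .
    qed
    then have norm_le: "AE x in \<nu>. norm x \<le> 1 / 2"
      unfolding \<nu>_def by (subst AE_distr_iff) auto
    have "riesz_energy \<alpha> \<nu> \<le> ennreal (\<Prod>i\<in>UNIV. (1 + 2 / (1 - a i)) * (c * r i / norm (v i)) powr (- a i))"
      unfolding \<nu>_def P_def
    proof (rule riesz_energy_distr_cube[OF _ a])
      show "T \<in> Pi\<^sub>M UNIV (\<lambda>_. uniform01) \<rightarrow>\<^sub>M borel" using T by (simp add: P_def)
      show "0 < c * r i / norm (v i)" for i using c r v_pos by simp
      fix f f' :: "'n \<Rightarrow> real" and i
      have "(T f - T f') \<bullet> v i = c * r i * (f i - f' i)"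
        by (simp add: inner_diff_left T_inner w if_distrib[of "\<lambda>u. _ * u"] right_diff_distrib cong: if_cong)
      then have "c * r i * \<bar>f i - f' i\<bar> = \<bar>(T f - T f') \<bullet> v i\<bar>"
        using c r[of i] by (simp add: abs_mult)
      also have "\<dots> \<le> norm (T f - T f') * norm (v i)" by (rule Cauchy_Schwarz_ineq2)
      finally show "c * r i / norm (v i) * \<bar>f i - f' i\<bar> \<le> norm (T f - T f')"
        using v_pos[of i] by (simp add: field_simps)
    qed
    also have "(\<Prod>i\<in>UNIV. (1 + 2 / (1 - a i)) * (c * r i / norm (v i)) powr (- a i)) = D * l powr S"
    proof -
      have "(c * r i / norm (v i)) powr (- a i) = (c / norm (v i)) powr (- a i) * l powr (a i * \<theta> i)" for i
      proof -
        have "(c * r i / norm (v i)) powr (- a i) = ((c / norm (v i)) * r i) powr (- a i)"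
          by (simp add: mult_ac)
        also have "\<dots> = (c / norm (v i)) powr (- a i) * r i powr (- a i)"
          using c r[of i] by (intro powr_mult)
        finally show ?thesis by (simp add: r_def powr_powr mult.commute)
      qed
      then show ?thesis
        using l by (simp add: D_def S_def prod.distrib powr_sum)
    qed
    finally have energy: "riesz_energy \<alpha> \<nu> \<le> ennreal (D * l powr S)" .
    have D: "0 \<le> D"
      unfolding D_def using a by (intro prod_nonneg) (auto simp: less_imp_le)
    \<comment> \<open>The side lengths are chosen so that the phase is bounded: \<open>r i * (l * t ^ e i) \<le> 1\<close>.\<close>
    have phase: "1 / 2 \<le> cmod (fourier_measure \<nu> (l *\<^sub>R \<gamma> t - l *\<^sub>R \<gamma> 0))" if t: "t \<in> {0..l powr (- s)}" for t
    proof (rule cmod_fourier_measure_ge_half[OF \<nu>.prob_space_axioms sets_\<nu>])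
      have "l powr (- s) \<le> l powr 0" using l s by (intro powr_mono) auto
      then have t01: "t \<in> {0..1}" using t l by auto
      have scale: "r i * (l * t ^ e i) \<le> 1" for i
      proof -
        have "t ^ e i \<le> (l powr (- s)) ^ e i" using t by (intro power_mono) auto
        then have "r i * (l * t ^ e i) \<le> r i * (l * (l powr (- s)) ^ e i)"
          using r[of i] l by (intro mult_left_mono) auto
        also have "\<dots> = l powr (- \<theta> i + (1 + real (e i) * (- s)))"
        proof -
          have pw: "(l powr (- s)) ^ e i = l powr (real (e i) * (- s))"
            using l by (simp add: powr_power mult.commute)
          show ?thesis unfolding pw r_def powr_add using l by simp
        qed
        also have "\<dots> \<le> l powr 0"
          using l by (intro powr_mono) (auto simp: \<theta>_def)
        finally show ?thesis using l by simp
      qed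
      have "AE f in P. \<bar>T f \<bullet> (l *\<^sub>R \<gamma> t - l *\<^sub>R \<gamma> 0)\<bar> \<le> 1"
        using cube
      proof eventually_elim
        case (elim f)
        have "\<bar>T f \<bullet> (l *\<^sub>R \<gamma> t - l *\<^sub>R \<gamma> 0)\<bar>
            \<le> (\<Sum>i\<in>UNIV. \<bar>(c * r i * f i) * (w i \<bullet> (l *\<^sub>R (\<gamma> t - \<gamma> 0)))\<bar>)"
          unfolding T_inner scaleR_diff_right by (rule sum_abs)
        also have "\<dots> \<le> (\<Sum>i\<in>UNIV. c * K i)"
        proof (rule sum_mono)
          fix i
          have "\<bar>(c * r i * f i) * (w i \<bullet> (l *\<^sub>R (\<gamma> t - \<gamma> 0)))\<bar>
              = (c * r i * f i) * (l * \<bar>w i \<bullet> (\<gamma> t - \<gamma> 0)\<bar>)"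
            using c r[of i] elim l by (simp add: abs_mult)
          also have "\<dots> \<le> (c * r i * 1) * (l * (K i * t ^ e i))"
            using c r[of i] elim l K(2)[OF t01, of i] by (intro mult_mono) auto
          also have "\<dots> = (c * K i) * (r i * (l * t ^ e i))" by (simp add: mult_ac)
          also have "\<dots> \<le> (c * K i) * 1"
            using c K(1)[of i] by (intro mult_left_mono scale) auto
          finally show "\<bar>(c * r i * f i) * (w i \<bullet> (l *\<^sub>R (\<gamma> t - \<gamma> 0)))\<bar> \<le> c * K i" by simp
        qed
        also have "\<dots> \<le> 1" using c by (simp add: sum_distrib_left)
        finally show ?case .
      qed
      then show "AE x in \<nu>. \<bar>x \<bullet> (l *\<^sub>R \<gamma> t - l *\<^sub>R \<gamma> 0)\<bar> \<le> 1"
        unfolding \<nu>_def by (subst AE_distr_iff) auto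
    qed
    let ?F = "\<lambda>t. (cmod (fourier_measure \<nu> (l *\<^sub>R \<gamma> t - l *\<^sub>R \<gamma> 0)))\<^sup>2"
    have "l powr (- s) \<le> l powr 0" using l s by (intro powr_mono) auto
    then have sub: "{0..l powr (- s)} \<subseteq> {0..1}" using l by auto
    have cont_F: "continuous_on {0..1} ?F"
      by (intro continuous_intros continuous_on_compose2[OF continuous_on_fourier_measure
            [OF \<nu>.finite_measure_axioms sets_\<nu>, of UNIV]] cont) auto
    have "l powr (- s) / 4 = integral {0..l powr (- s)} (\<lambda>t. 1 / 4)"
      by simp
    also have "\<dots> \<le> integral {0..l powr (- s)} ?F"
    proof (rule integral_le)
      show "?F integrable_on {0..l powr (- s)}"
        by (intro integrable_continuous_interval continuous_on_subset[OF cont_F sub])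
      show "1 / 4 \<le> ?F t" if "t \<in> {0..l powr (- s)}" for t
        using power_mono[OF phase[OF that], of 2] by (simp add: power2_eq_square)
      show "(\<lambda>t. 1 / 4) integrable_on {0..l powr (- s)}"
        by (rule integrable_const_ivl)
    qed
    also have "\<dots> \<le> integral {0..1} ?F"
      by (intro integral_subset_le[OF sub] integrable_continuous_interval cont_F
            continuous_on_subset[OF cont_F sub]) auto
    also have "\<dots> \<le> 16 * \<bar>C\<bar> * (D * l powr S) * l powr (- \<delta>)"
      using D by (intro mean_decay_translated[OF decay cont l \<nu>.finite_measure_axioms sets_\<nu> norm_le energy]) auto
    finally have "l powr (- s) / 4 * (4 * l powr (\<delta> - S))
        \<le> 16 * \<bar>C\<bar> * (D * l powr S) * l powr (- \<delta>) * (4 * l powr (\<delta> - S))"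
      by (intro mult_right_mono) auto
    also have "l powr (- s) / 4 * (4 * l powr (\<delta> - S)) = l powr (- s + (\<delta> - S))"
      unfolding powr_add by simp
    also have "- s + (\<delta> - S) = \<delta> - s - S"
      by simp
    also have "16 * \<bar>C\<bar> * (D * l powr S) * l powr (- \<delta>) * (4 * l powr (\<delta> - S))
        = 64 * \<bar>C\<bar> * D * l powr (S + - \<delta> + (\<delta> - S))"
      unfolding powr_add by simp
    also have "\<dots> = 64 * \<bar>C\<bar> * D"
      using l by simp
    finally show ?thesis .
  qed
  have "\<delta> - s - S \<le> 0" by (rule powr_bounded_imp_nonpos[OF main])
  then show ?thesis by (simp add: S_def \<theta>_def)
qed

section \<open>Optimising over boxes\<close>

lemma le_of_le_add_small_multiple:
  fixes x A B \<epsilon>\<^sub>0 :: real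
  assumes "0 < \<epsilon>\<^sub>0" and le: "\<And>\<epsilon>. 0 < \<epsilon> \<Longrightarrow> \<epsilon> < \<epsilon>\<^sub>0 \<Longrightarrow> x \<le> A + B * \<epsilon>"
  shows "x \<le> A"
proof (rule tendsto_lowerbound)
  show "((\<lambda>\<epsilon>. A + B * \<epsilon>) \<longlongrightarrow> A) (at_right 0)"
    by (auto intro!: tendsto_eq_intros)
  show "\<forall>\<^sub>F \<epsilon> in at_right 0. x \<le> A + B * \<epsilon>"
    using assms by (auto simp: eventually_at_right intro!: exI[of _ \<epsilon>\<^sub>0])
qed simp

lemma sum_two_block:
  fixes f :: "nat \<Rightarrow> real"
  assumes k: "1 \<le> k" "k \<le> d"
    and low: "\<And>j. 1 \<le> j \<Longrightarrow> j < k \<Longrightarrow> f j = 0" and high: "\<And>j. k < j \<Longrightarrow> j \<le> d \<Longrightarrow> f j = y"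
  shows "(\<Sum>j=1..d. f j) = f k + real (d - k) * y"
proof -
  have "(\<Sum>j=1..d. f j) = (\<Sum>j=k..d. f j)"
    using k low by (intro sum.mono_neutral_right) auto
  also have "\<dots> = f k + (\<Sum>j=Suc k..d. f j)"
    using k by (simp add: sum.atLeast_Suc_atMost)
  also have "(\<Sum>j=Suc k..d. f j) = (\<Sum>j=Suc k..d. y)"
    using high by (intro sum.cong) auto
  finally show ?thesis by simp
qed

context
  \<comment> \<open>The assumption \<open>box\<close> is the conclusion of \<open>decay_exponent_le_of_box\<close>, indexed by \<open>{1..d}\<close>.\<close>
  fixes \<alpha> \<delta> :: real and d :: nat
  assumes alpha: "0 < \<alpha>" "\<alpha> < real d"
    and box: "\<And>b s. (\<And>j. j \<in> {1..d} \<Longrightarrow> 0 \<le> b j) \<Longrightarrow> (\<And>j. j \<in> {1..d} \<Longrightarrow> b j < 1) \<Longrightarrow>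
      (\<Sum>j=1..d. b j) = \<alpha> \<Longrightarrow> 0 \<le> s \<Longrightarrow>
      \<delta> \<le> s + (\<Sum>j=1..d. b j * max 0 (1 - real j * s))"
begin

text \<open>With \<open>s = 0\<close> every side of the box has length comparable to \<open>1 / l\<close> and the whole curve is used.\<close>
lemma exponent_le_dimension: "\<delta> \<le> \<alpha>"
  using box[of "\<lambda>_. \<alpha> / real d" 0] alpha by simp

text \<open>For \<open>s = 1 / (k + 1)\<close> the sides in the directions \<open>j > k\<close> have length comparable to 1 and cost
  nothing; the side in direction \<open>k\<close> is \<open>l powr (- s)\<close>, and the shorter ones carry no exponent.\<close>
lemma exponent_le_two_block:
  assumes k: "1 \<le> k" "k < d" and x: "0 \<le> x" "x < 1" and y: "0 \<le> y" "y < 1"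
    and sum: "x + real (d - k) * y = \<alpha>"
  shows "\<delta> \<le> (1 + x) / (real k + 1)"
proof -
  define b where "b j = (if j < k then 0 else if j = k then x else y)" for j
  let ?s = "1 / (real k + 1)"
  have s: "1 - real k * ?s = ?s" by (simp add: field_simps)
  have "(\<Sum>j=1..d. b j) = b k + real (d - k) * y"
    using k by (intro sum_two_block) (auto simp: b_def)
  then have "(\<Sum>j=1..d. b j) = \<alpha>"
    using sum by (simp add: b_def)
  then have "\<delta> \<le> ?s + (\<Sum>j=1..d. b j * max 0 (1 - real j * ?s))"
    using x y by (intro box) (auto simp: b_def)
  also have "(\<Sum>j=1..d. b j * max 0 (1 - real j * ?s))
      = b k * max 0 (1 - real k * ?s) + real (d - k) * 0"
    using k by (intro sum_two_block) (auto simp: b_def max_def field_simps)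
  also have "\<dots> = x * ?s" unfolding s by (simp add: b_def)
  finally show ?thesis by (simp add: add_divide_distrib)
qed

text \<open>If \<open>\<alpha> \<le> d - k\<close>, the \<open>d - k\<close> long directions can absorb the whole kernel singularity. For
  \<open>\<alpha> = d - k\<close> they would all need the forbidden exponent 1, which is a logarithmic divergence; moving an
  arbitrarily small part \<open>\<alpha> * \<epsilon>\<close> to direction \<open>k\<close> avoids it.\<close>
lemma exponent_le_inverse:
  assumes k: "1 \<le> k" "k < d" and le: "\<alpha> \<le> real (d - k)"
  shows "\<delta> \<le> 1 / (real k + 1)"
proof (rule le_of_le_add_small_multiple)
  show "0 < min 1 (1 / \<alpha>)" using alpha by simp
  fix \<epsilon> :: real assume \<epsilon>: "0 < \<epsilon>" "\<epsilon> < min 1 (1 / \<alpha>)"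
  have dk: "real (d - k) > 0" using k by simp
  have "\<alpha> * (1 - \<epsilon>) < \<alpha> * 1" using alpha \<epsilon> by (intro mult_strict_left_mono) auto
  then have "\<alpha> * (1 - \<epsilon>) / real (d - k) < 1" using le dk by simp
  then have "\<delta> \<le> (1 + \<alpha> * \<epsilon>) / (real k + 1)"
    using alpha \<epsilon> dk k
    by (intro exponent_le_two_block[where y = "\<alpha> * (1 - \<epsilon>) / real (d - k)"])
      (auto simp: field_simps)
  then show "\<delta> \<le> 1 / (real k + 1) + \<alpha> / (real k + 1) * \<epsilon>"
    by (simp add: add_divide_distrib)
qed

text \<open>Here \<open>s = 1 / (k + 2)\<close>. The \<open>p = d - k - 1\<close> long directions can absorb only
  \<open>p * (1 - \<epsilon>)\<close> of the exponent \<open>\<alpha> > p\<close>; the rest, which is below 1, goes to direction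
  \<open>k + 1\<close>, of length \<open>l powr (- s)\<close>.\<close>
lemma exponent_le_fractional:
  assumes k: "k + 2 \<le> d" and gt: "real (d - k - 1) < \<alpha>" and lt: "\<alpha> < real (d - k)"
  shows "\<delta> \<le> 1 - (real d - \<alpha>) / (real k + 2)"
proof -
  define p where "p = real (d - k - 1)"
  have p: "1 \<le> p" "p = real d - real k - 1" "real (d - k) = p + 1"
    using k by (auto simp: p_def of_nat_diff)
  have "\<delta> \<le> (1 + (\<alpha> - p)) / (real k + 2)"
  proof (rule le_of_le_add_small_multiple)
    show "0 < min 1 ((p + 1 - \<alpha>) / p)" using p lt by simp
    fix \<epsilon> :: real assume \<epsilon>: "0 < \<epsilon>" "\<epsilon> < min 1 ((p + 1 - \<alpha>) / p)"
    have "p * \<epsilon> < p + 1 - \<alpha>" using \<epsilon> p(1) by (simp add: pos_less_divide_eq mult.commute)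
    moreover have "0 \<le> p * \<epsilon>" using \<epsilon> p by simp
    moreover have "p < \<alpha>" using gt by (simp only: p_def)
    moreover have "\<epsilon> < 1" using \<epsilon> by simp
    moreover have "\<alpha> - p + p * \<epsilon> + real (d - (k + 1)) * (1 - \<epsilon>) = \<alpha>"
      by (simp add: p_def[simplified] algebra_simps)
    ultimately have "\<delta> \<le> (1 + (\<alpha> - p + p * \<epsilon>)) / (real (k + 1) + 1)"
      using \<epsilon>(1) k by (intro exponent_le_two_block[where y = "1 - \<epsilon>"]) linarith+
    also have "\<dots> = (1 + (\<alpha> - p)) / (real k + 2) + p / (real k + 2) * \<epsilon>"
      by (simp add: add_divide_distrib diff_divide_distrib add.commute)
    finally show "\<delta> \<le> (1 + (\<alpha> - p)) / (real k + 2) + p / (real k + 2) * \<epsilon>" .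
  qed
  also have "\<dots> = 1 - (real d - \<alpha>) / (real k + 2)"
    by (simp add: p(2) field_simps)
  finally show ?thesis .
qed

lemma exponent_bound:
  assumes d: "2 \<le> d"
  shows "\<delta> \<le> (if real d - 1 < \<alpha> then 1 - (real d - \<alpha>) / 2
      else if 1 < \<alpha> then
        min (1 - (real d - \<alpha>) / (of_int \<lfloor>real d - \<alpha>\<rfloor> + 2)) (1 / (of_int \<lfloor>real d - \<alpha>\<rfloor> + 1))
      else min \<alpha> (1 / real d))"
proof -
  define k where "k = nat \<lfloor>real d - \<alpha>\<rfloor>"
  have floor_k: "\<lfloor>real d - \<alpha>\<rfloor> = int k" using alpha by (simp add: k_def)
  have k: "real k \<le> real d - \<alpha>" "real d - \<alpha> < real k + 1"
    using floor_k by linarith+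
  consider "real d - 1 < \<alpha>" | "1 < \<alpha>" "\<alpha> \<le> real d - 1" | "\<alpha> \<le> 1" "\<alpha> \<le> real d - 1"
    by linarith
  then show ?thesis
  proof cases
    case 1
    then show ?thesis using exponent_le_fractional[of 0] d alpha by (simp add: of_nat_diff)
  next
    case 2
    have "real k < real d - 1" using 2 k by linarith
    then have kd: "k + 2 \<le> d" "1 \<le> k" using 2 k by linarith+
    have inv: "\<delta> \<le> 1 / (real k + 1)"
      using kd k by (intro exponent_le_inverse) (auto simp: of_nat_diff)
    \<comment> \<open>For integer \<open>\<alpha>\<close> the bound \<open>1 - k / (k + 2) = 2 / (k + 2)\<close> is weaker than \<open>1 / (k + 1)\<close>.\<close>
    have "\<delta> \<le> 1 - (real d - \<alpha>) / (real k + 2)"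
    proof (cases "\<alpha> = real d - real k")
      case True
      have "1 / (real k + 1) \<le> 1 - (real d - \<alpha>) / (real k + 2)"
      proof -
        have "real d - \<alpha> = real k" using True by simp
        then show ?thesis by (simp add: field_simps)
      qed
      then show ?thesis using inv by linarith
    next
      case False
      then show ?thesis using kd k by (intro exponent_le_fractional) (auto simp: of_nat_diff)
    qed
    then show ?thesis using 2 inv by (simp add: floor_k)
  next
    case 3
    have "real d - 2 < real k" "real k < real d" using 3 k alpha by linarith+
    then have "k = d - 1" by linarith
    then have "\<delta> \<le> 1 / real d"
      using exponent_le_inverse[of "d - 1"] d 3 by (simp add: of_nat_diff)
    then show ?thesis using 3 exponent_le_dimension d by auto
  qed
qed

end

theorem proposition4p1:
  fixes \<gamma> :: "real \<Rightarrow> real ^ 'n" and e :: "'n \<Rightarrow> nat"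
    and d :: nat and \<alpha> \<delta> :: real
  assumes d_def: "d = CARD('n)"
    and d_ge: "d \<ge> 3"
    and alpha: "0 < \<alpha>" "\<alpha> < real d"
    and smooth: "Ck_on (d + 1) \<gamma> {0..1}"
    and numbering: "bij_betw e UNIV {1..d}"
    and torsion: "\<forall>t\<in>{0..1}. deriv_det e \<gamma> {0..1} t \<noteq> 0"
    and decay: "\<exists>C::real. \<forall>l::real. \<forall>\<mu>::(real ^ 'n) measure.
        l > 1 \<longrightarrow> sets \<mu> = sets borel \<longrightarrow> measure_support \<mu> \<subseteq> ball 0 1 \<longrightarrow> riesz_energy \<alpha> \<mu> = 1 \<longrightarrow>
        integral {0..1} (\<lambda>t. (cmod (fourier_measure \<mu> (l *\<^sub>R \<gamma> t)))\<^sup>2) \<le> C * l powr (- \<delta>)"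
  shows "\<delta> \<le> (if real d - 1 < \<alpha> then 1 - (real d - \<alpha>) / 2
      else if 1 < \<alpha> then
        min (1 - (real d - \<alpha>) / (of_int \<lfloor>real d - \<alpha>\<rfloor> + 2)) (1 / (of_int \<lfloor>real d - \<alpha>\<rfloor> + 1))
      else min \<alpha> (1 / real d))"
proof (rule exponent_bound)
  obtain C where C: "mean_decay \<alpha> \<delta> \<gamma> C"
    using decay unfolding mean_decay_def by blast
  have range_e: "range e = {1..d}" using numbering by (simp add: bij_betw_def)
  then have e: "1 \<le> e i" "e i \<le> d" for i by auto
  fix b :: "nat \<Rightarrow> real" and s :: real
  assume b: "\<And>j. j \<in> {1..d} \<Longrightarrow> 0 \<le> b j" "\<And>j. j \<in> {1..d} \<Longrightarrow> b j < 1" "(\<Sum>j=1..d. b j) = \<alpha>"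
    and s: "0 \<le> s"
  have reindex: "(\<Sum>i\<in>UNIV. f (e i)) = (\<Sum>j=1..d. f j)" for f :: "nat \<Rightarrow> real"
    by (rule sum.reindex_bij_betw[OF numbering])
  have "\<delta> \<le> s + (\<Sum>i\<in>UNIV. b (e i) * max 0 (1 - real (e i) * s))"
  proof (rule decay_exponent_le_of_box[OF C smooth])
    show "1 \<le> e i" "e i \<le> d + 1" for i using e[of i] by auto
    show "j \<in> range e" if "1 \<le> j" "j < e k" for j k
      using that e(2)[of k] unfolding range_e by auto
    show "deriv_det e \<gamma> {0..1} 0 \<noteq> 0" using torsion by simp
    show "0 \<le> b (e i)" "b (e i) < 1" for i using b(1,2)[of "e i"] e[of i] by auto
    show "(\<Sum>i\<in>UNIV. b (e i)) = \<alpha>" using reindex[of b] b(3) by simp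
  qed (rule s)
  then show "\<delta> \<le> s + (\<Sum>j=1..d. b j * max 0 (1 - real j * s))"
    using reindex[of "\<lambda>j. b j * max 0 (1 - real j * s)"] by simp
qed (use alpha d_ge in auto)

end
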